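(* Let $\mathcal H$ be a real Hilbert space, let $\mathcal X_n$ ($n\ge1$) be linear subspaces of $\mathcal H$, let $\mathcal E$ be a metric space, let $\Upsilon:\mathcal H\to\mathcal E$ and $\Upsilon_n:\mathcal X_n\to\mathcal E$ be maps, and let $\Phi:\mathcal E\to\mathbb R$ be continuous. Assume: (1) (i) For every $R>0$ the set $\{\Upsilon_n(h): h\in\mathcal X_n,\ \|h\|_{\mathcal H}\le R,\ n\ge1\}$ is relatively compact in $\mathcal E$; (ii) whenever $n_j\to+\infty$ and $h_j\in\mathcal X_{n_j}$ satisfy $h_j\rightharpoonup h$ weakly in $\mathcal H$, one has $\Upsilon_{n_j}(h_j)\to\Upsilon(h)$ in $\mathcal E$. (2) There are operators $Q_n:\mathcal H\to\mathcal X_n$, $n\ge 1$, such that $Q_nh\to h$ in $\mathcal H$ as $n\to\infty$ for every $h\in\mathcal H$. (3) Whenever $h_n^0\in\mathcal X_n$, $h\in\mathcal H$ and $h_n^0\to h$ in $\mathcal H$, then for every $q\in\mathcal H$, with $q_n:=Q_nq$, and every $a_0>0$, the family of maps $a\mapsto\Phi(\Upsilon_n(h_n^0+aq_n))$, $n\ge1$, is equicontinuous on $[-a_0,a_0]$. (4) The map $\mathcal T:\mathcal H\to\mathbb R$, $\mathcal T(h):=\Phi(\Upsilon(h))$, is $C^1$ on $\mathcal H$, and for every $h\in\mathcal H$ there is $q_h\in\mathcal H$ with $D\mathcal T(h)[q_h]\neq0$. Fix $y\in\mathbb R$ with $I(y)<+\infty$. Let $\epsilon_n\ge0$, $\epsilon_n\to0$,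 and let $h_n\in\mathcal X_n$ satisfy $$\Phi(\Upsilon_n(h_n))=y,\qquad \tfrac12\|h_n\|_{\mathcal H}^2\le\widehat I^n(y)+\epsilon_n .$$ Put $u_n:=\Upsilon_n(h_n)$. Then there exist a subsequence $\{n_k\}_{k\ge1}$ and $h^*\in\mathcal H$ such that, with $u^*:=\Upsilon(h^* )$, $$h_{n_k}\to h^*\ \text{ in }\mathcal H,\qquad u_{n_k}\to u^*\ \text{ in }\mathcal E,\qquad \Phi(u^* )=y,\qquad \tfrac12\|h^*\|_{\mathcal H}^2=I(y).$$ Consequently $h^*$ is a minimizing control (it attains the infimum defining $I(y)$) and $u^*$ minimizes $\mathcal J_y$ over $\mathcal E$, i.e. $\mathcal J_y(u^* )=\inf_{f\in\mathcal E}\mathcal J_y(f)$. If the minimizing control for the continuous problem (the minimizer $h$ in the definition of $I(y)$) is unique, then the full sequences satisfy $h_n\to h^*$ in $\mathcal H$ and $u_n\to u^*$ in $\mathcal E$.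
   Context: For $y\in\mathbb R$, $I(y):=\inf\{\frac12\|h\|_{\mathcal H}^2: h\in\mathcal H,\ \Phi(\Upsilon(h))=y\}$, $\widehat I^n(y):=\inf\{\frac12\|h_n\|_{\mathcal H}^2: h_n\in\mathcal X_n,\ \Phi(\Upsilon_n(h_n))=y\}$, and for $f\in\mathcal E$, $\mathcal J_y(f):=\inf\{\frac12\|h\|_{\mathcal H}^2: h\in\mathcal H,\ \Upsilon(h)=f,\ \Phi(f)=y\}$; so $I(y)=\inf_{f\in\mathcal E}\mathcal J_y(f)$. The infimum over the empty set is $+\infty$. $D\mathcal T(h)[q]$ denotes the (Fréchet) derivative of $\mathcal T$ at $h$ in direction $q$. *)

theory Defs
  imports "HOL-Analysis.Analysis"
begin

text \<open>Weak convergence is tested against all of the topological dual.\<close>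

definition weakly_converges :: "(nat \<Rightarrow> 'h::real_normed_vector) \<Rightarrow> 'h \<Rightarrow> bool" where
  "weakly_converges g h \<longleftrightarrow>
     (\<forall>f :: 'h \<Rightarrow> real. bounded_linear f \<longrightarrow> (\<lambda>j. f (g j)) \<longlonglongrightarrow> f h)"

definition relatively_compact :: "'e::topological_space set \<Rightarrow> bool" where
  "relatively_compact S \<longleftrightarrow> compact (closure S)"

text \<open>Pointwise equicontinuity relative to \<open>S\<close>; on a compact \<open>S\<close>, such as the intervals for
  which it is used, this is the same as uniform equicontinuity.\<close>

definition equicontinuous_family ::
    "'i set \<Rightarrow> 'a::metric_space set \<Rightarrow> ('i \<Rightarrow> 'a \<Rightarrow> 'b::metric_space) \<Rightarrow> bool" where
  "equicontinuous_family N S F \<longleftrightarrow>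
     (\<forall>x\<in>S. \<forall>e>0. \<exists>d>0. \<forall>i\<in>N. \<forall>x'\<in>S. dist x' x < d \<longrightarrow> dist (F i x') (F i x) < e)"

definition C1_map :: "('a::real_normed_vector \<Rightarrow> 'b::real_normed_vector) \<Rightarrow> bool" where
  "C1_map T \<longleftrightarrow>
     (\<exists>D :: 'a \<Rightarrow> 'a \<Rightarrow>\<^sub>L 'b.
        (\<forall>h. (T has_derivative blinfun_apply (D h)) (at h)) \<and> continuous_on UNIV D)"

text \<open>The costs below take values in the extended reals, where the infimum of the empty set
  is \<open>\<infinity>\<close>. The arguments \<open>U\<close> and \<open>V\<close> are the solution maps and \<open>X\<close> is the discrete control
  space; values of \<open>V\<close> off \<open>X\<close> play no role.\<close>

definition rate :: "('h::real_normed_vector \<Rightarrow> 'e) \<Rightarrow> ('e \<Rightarrow> real) \<Rightarrow> real \<Rightarrow> ereal" where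
  "rate U \<Phi> y = Inf {ereal (1/2 * (norm h)\<^sup>2) | h. \<Phi> (U h) = y}"

definition discrete_rate ::
    "'h::real_normed_vector set \<Rightarrow> ('h \<Rightarrow> 'e) \<Rightarrow> ('e \<Rightarrow> real) \<Rightarrow> real \<Rightarrow> ereal" where
  "discrete_rate X V \<Phi> y = Inf {ereal (1/2 * (norm h)\<^sup>2) | h. h \<in> X \<and> \<Phi> (V h) = y}"

definition state_cost ::
    "('h::real_normed_vector \<Rightarrow> 'e) \<Rightarrow> ('e \<Rightarrow> real) \<Rightarrow> real \<Rightarrow> 'e \<Rightarrow> ereal" where
  "state_cost U \<Phi> y f = Inf {ereal (1/2 * (norm h)\<^sup>2) | h. U h = f \<and> \<Phi> f = y}"

definition minimizing_control ::
    "('h::real_normed_vector \<Rightarrow> 'e) \<Rightarrow> ('e \<Rightarrow> real) \<Rightarrow> real \<Rightarrow> 'h \<Rightarrow> bool" where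
  "minimizing_control U \<Phi> y h \<longleftrightarrow> \<Phi> (U h) = y \<and> ereal (1/2 * (norm h)\<^sup>2) = rate U \<Phi> y"

end

theory Submission
  imports Defs "HOL-Complex_Analysis.Great_Picard"
begin

text \<open>Upper bound: a feasible \<open>g\<close> is perturbed along a direction \<open>q\<close> in which the derivative of
  \<open>\<Phi> \<circ> \<Upsilon>\<close> does not vanish, so that \<open>a \<mapsto> \<Phi> (\<Upsilon> (g + a q))\<close> crosses the level \<open>y\<close> strictly at
  \<open>a = 0\<close>. The discrete maps \<open>a \<mapsto> \<Phi> (\<Upsilon>\<^sub>n (Q\<^sub>n g + a Q\<^sub>n q))\<close> are continuous and converge pointwise,
  hence by the intermediate value theorem they attain \<open>y\<close> at arbitrarily small \<open>a\<close> for large \<open>n\<close>.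
  This gives \<open>limsup \<parallel>h\<^sub>n\<parallel> \<le> \<parallel>g\<parallel>\<close> for every feasible \<open>g\<close>. In particular \<open>h\<^sub>n\<close> is bounded, and
  any weak subsequential limit \<open>x\<close> is feasible by weak consistency. Taking \<open>g = x\<close> upgrades the weak
  convergence to norm convergence, and arbitrary \<open>g\<close> then show that \<open>x\<close> is minimizing.\<close>

section \<open>Hilbert space tools: Riesz representation and weak compactness of bounded
  sequences\<close>

text \<open>With \<open>f = (\<lambda>v. v \<bullet> x)\<close> this also provides the orthogonal projection of \<open>x\<close> to \<open>S\<close>. The
  representing vector minimizes \<open>\<parallel>v\<parallel>\<^sup>2 - 2 f v\<close> over \<open>S\<close>.\<close>

lemma riesz_on_closed_subspace:
  fixes f :: "'h::{real_inner, complete_space} \<Rightarrow> real"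
  assumes f: "bounded_linear f" and S: "subspace S" "closed S"
  obtains w where "w \<in> S" "\<And>v. v \<in> S \<Longrightarrow> f v = v \<bullet> w"
proof -
  interpret f: bounded_linear f by (fact f)
  define J where "J v = (norm v)\<^sup>2 - 2 * f v" for v
  define m where "m = Inf (J ` S)"
  obtain K where K: "\<And>v. norm (f v) \<le> norm v * K"
    using f.bounded by blast
  \<comment> \<open>Complete the square in \<open>norm v\<close>.\<close>
  have J_ge: "- K\<^sup>2 \<le> J v" for v
  proof -
    have "f v \<le> norm v * K" using K[of v] by simp
    moreover have "0 \<le> (norm v - K)\<^sup>2" by simp
    ultimately show ?thesis by (simp add: J_def power2_diff)
  qed
  have bdd: "bdd_below (J ` S)"
    using J_ge by (auto intro!: bdd_belowI)
  have ne: "J ` S \<noteq> {}" using subspace_0[OF S(1)] by auto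
  have m_le: "m \<le> J v" if "v \<in> S" for v
    unfolding m_def using bdd that by (auto intro: cInf_lower)
  have "\<exists>v\<in>S. J v < m + 1 / real (Suc n)" for n
  proof -
    have "Inf (J ` S) < m + 1 / real (Suc n)" by (simp add: m_def)
    then show ?thesis using cInf_lessD[OF ne] by blast
  qed
  then obtain v where vS: "\<And>n. v n \<in> S" and vJ: "\<And>n. J (v n) < m + 1 / real (Suc n)"
    by metis
  \<comment> \<open>Parallelogram law: the linear parts of \<open>J\<close> cancel. As the midpoint
    lies in \<open>S\<close>, where \<open>J\<close> is at least \<open>m\<close>, a minimizing
    sequence is Cauchy.\<close>
  have par: "(norm (a - b))\<^sup>2 = 2 * J a + 2 * J b - 4 * J ((1/2) *\<^sub>R (a + b))" for a b
    by (simp add: J_def f.add f.scaleR power2_norm_eq_inner inner_simps inner_commute algebra_simps)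
  have close: "(norm (v i - v j))\<^sup>2 < 2 / real (Suc i) + 2 / real (Suc j)" for i j
  proof -
    have "(1/2) *\<^sub>R (v i + v j) \<in> S" by (intro subspace_scale subspace_add S vS)
    from m_le[OF this] show ?thesis using vJ[of i] vJ[of j] par[of "v i" "v j"] by linarith
  qed
  have "Cauchy v"
  proof (rule metric_CauchyI)
    fix e :: real assume e: "0 < e"
    obtain N where N: "4 / e\<^sup>2 < real N" using reals_Archimedean2 by blast
    have "dist (v i) (v j) < e" if ij: "N \<le> i" "N \<le> j" for i j
    proof -
      have pos: "0 < real N" using N e by (meson divide_pos_pos less_trans zero_less_numeral zero_less_power)
      have "2 / real (Suc i) \<le> 2 / real N" "2 / real (Suc j) \<le> 2 / real N"
        using ij pos by (auto intro!: divide_left_mono)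
      then have "(norm (v i - v j))\<^sup>2 < 4 / real N" using close[of i j] by simp
      also have "\<dots> < e\<^sup>2" using N e pos by (simp add: field_simps)
      finally show ?thesis using e by (simp add: dist_norm power2_less_imp_less)
    qed
    then show "\<exists>M. \<forall>i\<ge>M. \<forall>j\<ge>M. dist (v i) (v j) < e" by blast
  qed
  then obtain w where w: "v \<longlonglongrightarrow> w" by (meson Cauchy_convergent convergentD)
  have wS: "w \<in> S" using closed_sequentially[OF S(2) vS w] .
  have "(\<lambda>n. J (v n)) \<longlonglongrightarrow> J w"
    unfolding J_def by (intro tendsto_intros f.tendsto w)
  moreover have "(\<lambda>n. m + 1 / real (Suc n)) \<longlonglongrightarrow> m + 0"
    by (intro tendsto_intros LIMSEQ_Suc[OF lim_1_over_n])
  ultimately have Jw: "J w \<le> m"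
    using vJ by (intro LIMSEQ_le[of "\<lambda>n. J (v n)" "J w" "\<lambda>n. m + 1 / real (Suc n)" m])
      (auto intro: less_imp_le)
  have "f x = x \<bullet> w" if x: "x \<in> S" for x
  proof -
    define c where "c = x \<bullet> w - f x"
    define d where "d = (norm x)\<^sup>2 + 1"
    have d: "0 < d" by (simp add: d_def add_nonneg_pos)
    \<comment> \<open>First variation at \<open>w\<close>: \<open>J (w + t *\<^sub>R x)\<close>
      exceeds \<open>J w\<close> by \<open>2 * t * c + t\<^sup>2 * (norm x)\<^sup>2\<close>. The
      best \<open>t\<close> is \<open>- c / (norm x)\<^sup>2\<close>; the extra 1 in
      \<open>d\<close> covers \<open>x = 0\<close> and still leaves a negative value unless
      \<open>c = 0\<close>.\<close>
    define t where "t = - c / d"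
    have "m \<le> J (w + t *\<^sub>R x)" by (intro m_le subspace_add subspace_scale S wS x)
    also have "\<dots> = J w + 2 * t * c + t\<^sup>2 * (d - 1)"
      unfolding J_def c_def d_def power2_norm_eq_inner
      by (simp add: f.add f.scaleR inner_simps inner_commute algebra_simps power2_eq_square)
    finally have "0 \<le> 2 * t * c + t\<^sup>2 * (d - 1)" using Jw by simp
    also have "\<dots> = - c\<^sup>2 * (d + 1) / d\<^sup>2"
      using d unfolding t_def by (simp add: field_simps power2_eq_square)
    finally have "c\<^sup>2 * (d + 1) \<le> 0" using d by (simp add: field_simps)
    then have "c = 0" using d by (simp add: mult_le_0_iff)
    then show ?thesis by (simp add: c_def)
  qed
  with wS show ?thesis using that by blast
qed

text \<open>The space may be nonseparable, so the diagonal extraction runs over the countable set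
  \<open>range g\<close>. The pointwise limit of the functionals along the subsequence is bounded,
  and its Riesz vector is the weak limit.\<close>

lemma bounded_seq_weakly_convergent_subseq:
  fixes g :: "nat \<Rightarrow> 'h::{real_inner, complete_space}"
  assumes B: "\<And>n. norm (g n) \<le> B"
  obtains r x where "strict_mono r" "weakly_converges (g \<circ> r) x"
proof -
  have B0: "0 \<le> B" using B[of 0] norm_ge_zero order_trans by blast
  have "norm (g n \<bullet> z) \<le> B * B" if "z \<in> range g" for n z
  proof -
    have "norm (g n \<bullet> z) \<le> norm (g n) * norm z" by (simp add: Cauchy_Schwarz_ineq2)
    also have "\<dots> \<le> B * B" using that B B0 by (intro mult_mono) auto
    finally show ?thesis .
  qed
  then obtain r where r: "strict_mono r"
    and r_lim: "\<And>z. z \<in> range g \<Longrightarrow> \<exists>l. (\<lambda>k. g (r k) \<bullet> z) \<longlonglongrightarrow> l"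
    using function_convergent_subsequence[of "range g" "\<lambda>n z. g n \<bullet> z" "B * B"]
    by (metis countable_image countableI_type)
  \<comment> \<open>\<open>V\<close> is a closed subspace containing every \<open>g n\<close>, and projecting a vector to \<open>V\<close> does not
    change its inner products with the \<open>g n\<close>; so \<open>V\<close> is the whole space.\<close>
  define V where "V = {v. convergent (\<lambda>k. g (r k) \<bullet> v)}"
  have bound: "\<bar>g n \<bullet> v\<bar> \<le> B * norm v" for n v
    using Cauchy_Schwarz_ineq2[of "g n" v] mult_right_mono[OF B norm_ge_zero] order_trans by blast
  have gV: "g n \<in> V" for n using r_lim unfolding V_def convergent_def by blast
  have subV: "subspace V"
    unfolding subspace_def V_def
    by (auto simp: inner_right_distrib convergent_const
        intro: convergent_add convergent_mult[OF convergent_const])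
  have "closed V"
    unfolding closed_sequential_limits
  proof (intro allI impI, elim conjE)
    fix x l assume x: "\<forall>n. x n \<in> V" "x \<longlonglongrightarrow> l"
    have "Cauchy (\<lambda>k. g (r k) \<bullet> l)"
    proof (rule metric_CauchyI)
      fix e :: real assume e: "0 < e"
      \<comment> \<open>Scale for a three-epsilon argument; \<open>B + 1\<close> avoids division by
        zero when \<open>B = 0\<close>.\<close>
      define e' where "e' = e / (3 * (B + 1))"
      have e': "0 < e'" using e B0 by (simp add: e'_def)
      have small: "B * e' < e / 3" using e B0 by (simp add: e'_def field_simps)
      obtain n where n: "dist (x n) l < e'"
        using metric_LIMSEQ_D[OF x(2) e'] by blast
      have near: "\<bar>g (r k) \<bullet> (x n) - g (r k) \<bullet> l\<bar> < e / 3" for k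
      proof -
        have "\<bar>g (r k) \<bullet> (x n - l)\<bar> \<le> B * norm (x n - l)" by (rule bound)
        also have "\<dots> \<le> B * e'" using n B0 by (intro mult_left_mono) (auto simp: dist_norm)
        finally show ?thesis using small by (simp add: inner_diff_right)
      qed
      have "Cauchy (\<lambda>k. g (r k) \<bullet> x n)"
        using x(1) by (auto simp: V_def intro: convergent_Cauchy)
      then obtain N where N: "\<And>i j. N \<le> i \<Longrightarrow> N \<le> j \<Longrightarrow> \<bar>g (r i) \<bullet> x n - g (r j) \<bullet> x n\<bar> < e / 3"
        using e metric_CauchyD[of "\<lambda>k. g (r k) \<bullet> x n" "e / 3"] by (auto simp: dist_real_def)
      have "dist (g (r i) \<bullet> l) (g (r j) \<bullet> l) < e" if "N \<le> i" "N \<le> j" for i j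
        using N[OF that] near[of i] near[of j] unfolding dist_real_def by linarith
      then show "\<exists>M. \<forall>i\<ge>M. \<forall>j\<ge>M. dist (g (r i) \<bullet> l) (g (r j) \<bullet> l) < e" by blast
    qed
    then show "l \<in> V" by (simp add: V_def real_Cauchy_convergent)
  qed
  have conv: "convergent (\<lambda>k. g (r k) \<bullet> v)" for v
  proof -
    obtain p where p: "p \<in> V" "\<And>z. z \<in> V \<Longrightarrow> z \<bullet> v = z \<bullet> p"
      using riesz_on_closed_subspace[OF bounded_linear_inner_left[of v] subV \<open>closed V\<close>] by blast
    then show ?thesis using gV by (simp add: V_def)
  qed
  define L where "L v = lim (\<lambda>k. g (r k) \<bullet> v)" for v
  have L: "(\<lambda>k. g (r k) \<bullet> v) \<longlonglongrightarrow> L v" for v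
    using conv[of v] by (simp add: L_def convergent_LIMSEQ_iff)
  have "bounded_linear L"
  proof (rule bounded_linear_intro[where K = B])
    show "L (a + b) = L a + L b" for a b
      using LIMSEQ_unique[OF L[of "a + b"]] tendsto_add[OF L[of a] L[of b]]
      by (simp add: inner_add_right)
    show "L (c *\<^sub>R a) = c *\<^sub>R L a" for c a
      using LIMSEQ_unique[OF L[of "c *\<^sub>R a"]] tendsto_mult[OF tendsto_const L[of a], of c]
      by simp
    show "norm (L v) \<le> norm v * B" for v
      by (rule LIMSEQ_le_const2[OF tendsto_norm[OF L[of v]]])
        (use bound in \<open>auto simp: mult.commute\<close>)
  qed
  then obtain x where x: "\<And>v. L v = v \<bullet> x"
    using riesz_on_closed_subspace[of L UNIV] by auto
  have "weakly_converges (g \<circ> r) x"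
    unfolding weakly_converges_def
  proof (intro allI impI)
    fix f :: "'h \<Rightarrow> real" assume "bounded_linear f"
    then obtain w where w: "\<And>v. f v = v \<bullet> w"
      using riesz_on_closed_subspace[of f UNIV] by auto
    show "(\<lambda>j. f ((g \<circ> r) j)) \<longlonglongrightarrow> f x"
      using L[of w] by (simp add: w x inner_commute)
  qed
  with r show ?thesis using that by blast
qed

lemma tendsto_imp_weakly_converges: "g \<longlonglongrightarrow> x \<Longrightarrow> weakly_converges g x"
  by (simp add: weakly_converges_def bounded_linear.tendsto)

text \<open>The Radon-Riesz property: in the expansion of \<open>(norm (g n - x))\<^sup>2\<close>,
  weak convergence controls the cross term and the hypothesis on norms controls the rest.\<close>

lemma weakly_converges_limsup_norm_imp_tendsto:
  fixes x :: "'h::real_inner"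
  assumes weak: "weakly_converges g x"
    and norms: "\<And>c. (norm x)\<^sup>2 < c \<Longrightarrow> \<forall>\<^sub>F n in sequentially. (norm (g n))\<^sup>2 < c"
  shows "g \<longlonglongrightarrow> x"
proof (rule tendstoI)
  fix e :: real assume e: "0 < e"
  have "(\<lambda>n. g n \<bullet> x) \<longlonglongrightarrow> x \<bullet> x"
    using weak bounded_linear_inner_left[of x] unfolding weakly_converges_def by blast
  \<comment> \<open>The cross term enters twice, so tolerances of one quarter here and one half
    below add up to \<open>e\<^sup>2\<close>.\<close>
  then have "\<forall>\<^sub>F n in sequentially. (norm x)\<^sup>2 - e\<^sup>2 / 4 < g n \<bullet> x"
    using e by (intro order_tendstoD(1)) (auto simp: power2_norm_eq_inner)
  moreover have "\<forall>\<^sub>F n in sequentially. (norm (g n))\<^sup>2 < (norm x)\<^sup>2 + e\<^sup>2 / 2"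
    using e by (intro norms) simp
  ultimately show "\<forall>\<^sub>F n in sequentially. dist (g n) x < e"
  proof eventually_elim
    case (elim n)
    have "(norm (g n - x))\<^sup>2 = (norm (g n))\<^sup>2 - 2 * (g n \<bullet> x) + (norm x)\<^sup>2"
      by (simp add: power2_norm_eq_inner inner_simps inner_commute)
    then have "(norm (g n - x))\<^sup>2 < e\<^sup>2" using elim by simp
    then show ?case using e by (simp add: dist_norm power2_less_imp_less)
  qed
qed

section \<open>Level crossing on the line and convergence by subsequences\<close>

lemma equicontinuous_family_imp_continuous_on:
  assumes "equicontinuous_family N S F" "i \<in> N"
  shows "continuous_on S (F i)"
  using assms unfolding equicontinuous_family_def continuous_on_iff by metis

text \<open>A nonzero derivative puts \<open>f t\<close> and \<open>f (- t)\<close> strictly on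
  opposite sides of \<open>f 0\<close> for small \<open>t > 0\<close>. Convergence at these two
  points passes the strict inequalities to \<open>F n\<close>, and the intermediate value theorem
  applies.\<close>

lemma eventually_level_attained:
  fixes F :: "nat \<Rightarrow> real \<Rightarrow> real"
  assumes deriv: "(f has_real_derivative l) (at 0)" "l \<noteq> 0"
    and d: "0 < d"
    and cont: "\<And>n. n \<ge> 1 \<Longrightarrow> continuous_on {-d..d} (F n)"
    and lim: "\<And>a. (\<lambda>n. F n a) \<longlonglongrightarrow> f a"
  shows "\<forall>\<^sub>F n in sequentially. \<exists>a. \<bar>a\<bar> \<le> d \<and> F n a = f 0"
proof -
  \<comment> \<open>Generalized over \<open>F\<close>, \<open>f\<close> and \<open>l\<close>, so
    that negative \<open>l\<close> reduces to this case by changing signs.\<close>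
  have pos: "\<forall>\<^sub>F n in sequentially. \<exists>a. \<bar>a\<bar> \<le> d \<and> F n a = f 0"
    if der: "(f has_real_derivative l) (at 0)" "0 < l"
      and cont: "\<And>n. n \<ge> 1 \<Longrightarrow> continuous_on {-d..d} (F n)"
      and lim: "\<And>a. (\<lambda>n. F n a) \<longlonglongrightarrow> f a"
    for F :: "nat \<Rightarrow> real \<Rightarrow> real" and f l
  proof -
    obtain d1 where d1: "0 < d1" "\<And>t. 0 < t \<Longrightarrow> t < d1 \<Longrightarrow> f 0 < f (0 + t)"
      using DERIV_pos_inc_right[OF der] by blast
    obtain d2 where d2: "0 < d2" "\<And>t. 0 < t \<Longrightarrow> t < d2 \<Longrightarrow> f (0 - t) < f 0"
      using DERIV_pos_inc_left[OF der] by blast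
    define t where "t = min d (min d1 d2) / 2"
    have t: "0 < t" "t < d1" "t < d2" "t \<le> d"
      using d d1(1) d2(1) by (auto simp: t_def)
    have "f 0 < f t" "f (- t) < f 0" using d1(2)[of t] d2(2)[of t] t by auto
    then have "\<forall>\<^sub>F n in sequentially. f 0 < F n t" "\<forall>\<^sub>F n in sequentially. F n (- t) < f 0"
      using order_tendstoD[OF lim] by blast+
    with eventually_ge_at_top[of 1] show ?thesis
    proof eventually_elim
      case (elim n)
      have "continuous_on {-t..t} (F n)"
        using cont[OF elim(1)] t by (auto intro: continuous_on_subset)
      then obtain a where "- t \<le> a" "a \<le> t" "F n a = f 0"
        using IVT'[of "F n" "- t" "f 0" t] elim t by auto
      then show ?case using t by (intro exI[of _ a]) auto
    qed
  qed
  show ?thesis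
  proof (cases "0 < l")
    case True
    then show ?thesis using pos[OF deriv(1) _ cont lim] by blast
  next
    case False
    have "\<forall>\<^sub>F n in sequentially. \<exists>a. \<bar>a\<bar> \<le> d \<and> - F n a = - f 0"
      using False deriv
      by (intro pos[of "\<lambda>a. - f a" "- l" "\<lambda>n a. - F n a"] DERIV_minus continuous_on_minus
          tendsto_minus cont lim) auto
    then show ?thesis by simp
  qed
qed

text \<open>If a neighbourhood of \<open>L\<close> is missed infinitely often, enumerating the bad
  indices gives a subsequence that no reindexing brings back to \<open>L\<close>.\<close>

lemma tendsto_if_subsubseq_tendsto:
  fixes X :: "nat \<Rightarrow> 'a::topological_space"
  assumes "\<And>s :: nat \<Rightarrow> nat. strict_mono s \<Longrightarrow> \<exists>r :: nat \<Rightarrow> nat. (\<lambda>k. X (s (r k))) \<longlonglongrightarrow> L"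
  shows "X \<longlonglongrightarrow> L"
proof (rule topological_tendstoI, rule ccontr)
  fix S assume S: "open S" "L \<in> S" and "\<not> (\<forall>\<^sub>F n in sequentially. X n \<in> S)"
  then have inf: "infinite {n. X n \<notin> S}"
    by (simp add: not_eventually cofinite_eq_sequentially[symmetric] frequently_cofinite)
  define s where "s = enumerate {n. X n \<notin> S}"
  have s: "strict_mono s" "\<And>k. X (s k) \<notin> S"
    using strict_mono_enumerate[OF inf] enumerate_in_set[OF inf] by (auto simp: s_def)
  obtain r where "(\<lambda>k. X (s (r k))) \<longlonglongrightarrow> L" using assms[OF s(1)] by blast
  then have "\<forall>\<^sub>F k in sequentially. X (s (r k)) \<in> S" using S by (rule topological_tendstoD)
  then show False using s(2) by simp
qed

section \<open>Comparison of the cost functionals\<close>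

lemma rate_le: "\<Phi> (U g) = y \<Longrightarrow> rate U \<Phi> y \<le> ereal (1/2 * (norm g)\<^sup>2)"
  unfolding rate_def by (rule Inf_lower) auto

lemma discrete_rate_le:
  "g \<in> X \<Longrightarrow> \<Phi> (V g) = y \<Longrightarrow> discrete_rate X V \<Phi> y \<le> ereal (1/2 * (norm g)\<^sup>2)"
  unfolding discrete_rate_def by (rule Inf_lower) auto

lemma minimizing_controlI:
  assumes "\<Phi> (U g) = y" "\<And>g'. \<Phi> (U g') = y \<Longrightarrow> norm g \<le> norm g'"
  shows "minimizing_control U \<Phi> y g"
proof -
  have "ereal (1/2 * (norm g)\<^sup>2) \<le> rate U \<Phi> y"
    unfolding rate_def using assms(2) by (intro Inf_greatest) (auto intro: power_mono)
  then show ?thesis using assms(1) rate_le[of \<Phi> U g y] by (auto simp: minimizing_control_def)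
qed

text \<open>The control \<open>g\<close> itself bounds the cost of \<open>U g\<close> by
  \<open>rate\<close>, while each set defining a \<open>state_cost\<close> lies inside the one
  defining \<open>rate\<close>.\<close>

lemma minimizing_control_state_cost:
  assumes "minimizing_control U \<Phi> y g"
  shows "state_cost U \<Phi> y (U g) = (INF f. state_cost U \<Phi> y f)"
proof (rule antisym)
  have "state_cost U \<Phi> y (U g) \<le> ereal (1/2 * (norm g)\<^sup>2)"
    unfolding state_cost_def using assms
    by (intro Inf_lower CollectI exI[of _ g]) (simp add: minimizing_control_def)
  also have "\<dots> = rate U \<Phi> y" using assms by (simp add: minimizing_control_def)
  also have "\<dots> \<le> (INF f. state_cost U \<Phi> y f)"
    unfolding rate_def state_cost_def by (intro INF_greatest Inf_superset_mono) auto
  finally show "state_cost U \<Phi> y (U g) \<le> (INF f. state_cost U \<Phi> y f)" .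
qed (rule INF_lower, simp)

theorem corollary2p12:
  fixes X :: "nat \<Rightarrow> 'h::{real_inner, complete_space} set"
    and \<Upsilon> :: "'h \<Rightarrow> 'e::metric_space"
    and \<Upsilon>n :: "nat \<Rightarrow> 'h \<Rightarrow> 'e"
    and \<Phi> :: "'e \<Rightarrow> real"
    and Q :: "nat \<Rightarrow> 'h \<Rightarrow> 'h"
    and y :: real
    and \<epsilon> :: "nat \<Rightarrow> real"
    and h :: "nat \<Rightarrow> 'h"
    and u :: "nat \<Rightarrow> 'e"
  assumes subspaces: "\<And>n. n \<ge> 1 \<Longrightarrow> subspace (X n)"
    and Phi_cont: "continuous_on UNIV \<Phi>"
    and compactness:
      "\<And>R. R > 0 \<Longrightarrow> relatively_compact {\<Upsilon>n n g | n g. n \<ge> 1 \<and> g \<in> X n \<and> norm g \<le> R}"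
    and weak_consistency:
      "\<And>(m :: nat \<Rightarrow> nat) g g0. filterlim m at_top sequentially \<Longrightarrow>
         (\<And>j. m j \<ge> 1 \<and> g j \<in> X (m j)) \<Longrightarrow> weakly_converges g g0 \<Longrightarrow>
         (\<lambda>j. \<Upsilon>n (m j) (g j)) \<longlonglongrightarrow> \<Upsilon> g0"
    and Q_range: "\<And>n g. n \<ge> 1 \<Longrightarrow> Q n g \<in> X n"
    and Q_lim: "\<And>g. (\<lambda>n. Q n g) \<longlonglongrightarrow> g"
    and equicont:
      "\<And>g g0 q (a0 :: real). (\<And>n. n \<ge> 1 \<Longrightarrow> g n \<in> X n) \<Longrightarrow> g \<longlonglongrightarrow> g0 \<Longrightarrow> a0 > 0 \<Longrightarrow>
         equicontinuous_family {1..} {-a0..a0} (\<lambda>n a. \<Phi> (\<Upsilon>n n (g n + a *\<^sub>R Q n q)))"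
    and C1: "C1_map (\<lambda>g. \<Phi> (\<Upsilon> g))"
    and nondegenerate: "\<And>g. \<exists>q. frechet_derivative (\<lambda>g. \<Phi> (\<Upsilon> g)) (at g) q \<noteq> 0"
    and finite_rate: "rate \<Upsilon> \<Phi> y < \<infinity>"
    and eps_nonneg: "\<And>n. n \<ge> 1 \<Longrightarrow> \<epsilon> n \<ge> 0"
    and eps_lim: "\<epsilon> \<longlonglongrightarrow> 0"
    and h_in: "\<And>n. n \<ge> 1 \<Longrightarrow> h n \<in> X n"
    and h_feasible: "\<And>n. n \<ge> 1 \<Longrightarrow> \<Phi> (\<Upsilon>n n (h n)) = y"
    and h_almost_min:
      "\<And>n. n \<ge> 1 \<Longrightarrow> ereal (1/2 * (norm (h n))\<^sup>2) \<le> discrete_rate (X n) (\<Upsilon>n n) \<Phi> y + ereal (\<epsilon> n)"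
    and u_eq: "\<And>n. n \<ge> 1 \<Longrightarrow> u n = \<Upsilon>n n (h n)"
  shows "\<exists>(r :: nat \<Rightarrow> nat) hstar ustar.
           strict_mono r \<and> (\<forall>k. r k \<ge> 1) \<and> ustar = \<Upsilon> hstar \<and>
           (\<lambda>k. h (r k)) \<longlonglongrightarrow> hstar \<and>
           (\<lambda>k. u (r k)) \<longlonglongrightarrow> ustar \<and>
           \<Phi> ustar = y \<and>
           ereal (1/2 * (norm hstar)\<^sup>2) = rate \<Upsilon> \<Phi> y \<and>
           minimizing_control \<Upsilon> \<Phi> y hstar \<and>
           state_cost \<Upsilon> \<Phi> y ustar = (INF f. state_cost \<Upsilon> \<Phi> y f) \<and>
           ((\<exists>!g. minimizing_control \<Upsilon> \<Phi> y g) \<longrightarrow> h \<longlonglongrightarrow> hstar \<and> u \<longlonglongrightarrow> ustar)"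
proof -
  \<comment> \<open>Norm convergence is a case of weak convergence. Index 0 carries no hypotheses,
    hence the shift by \<open>Suc\<close>.\<close>
  have strong: "(\<lambda>n. \<Upsilon>n n (g n)) \<longlonglongrightarrow> \<Upsilon> g0"
    if "\<And>n. n \<ge> 1 \<Longrightarrow> g n \<in> X n" "g \<longlonglongrightarrow> g0" for g g0
  proof (rule LIMSEQ_imp_Suc, rule weak_consistency)
    show "weakly_converges (\<lambda>n. g (Suc n)) g0"
      by (intro tendsto_imp_weakly_converges LIMSEQ_Suc that(2))
  qed (simp_all add: filterlim_Suc that(1))
  have Phi_tendsto: "(\<lambda>n. \<Phi> (f n)) \<longlonglongrightarrow> \<Phi> f0" if "f \<longlonglongrightarrow> f0" for f f0
    using continuous_on_tendsto_compose[OF Phi_cont that] by simp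

  have recovery: "\<forall>\<^sub>F n in sequentially. \<exists>v\<in>X n. \<Phi> (\<Upsilon>n n v) = y \<and> norm v < s"
    if g: "\<Phi> (\<Upsilon> g) = y" and s: "norm g < s" for g s
  proof -
    obtain q where q: "frechet_derivative (\<lambda>g. \<Phi> (\<Upsilon> g)) (at g) q \<noteq> 0"
      using nondegenerate by blast
    obtain D where D: "((\<lambda>g. \<Phi> (\<Upsilon> g)) has_derivative blinfun_apply D) (at g)"
      using C1 unfolding C1_map_def by blast
    have Dq: "blinfun_apply D q \<noteq> 0" using q frechet_derivative_at[OF D] by metis
    \<comment> \<open>Perturbations \<open>a *\<^sub>R q\<close> with
      \<open>\<bar>a\<bar> \<le> d\<close> must keep the norm below \<open>s\<close>; the
      \<open>+ 1\<close> makes this strict, so it survives replacing \<open>g\<close> and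
      \<open>q\<close> by their images under \<open>Q n\<close> for large \<open>n\<close>.\<close>
    define d where "d = (s - norm g) / (norm q + 1)"
    have d: "0 < d" using s by (simp add: d_def add_nonneg_pos)
    have dq: "norm g + d * norm q < s"
    proof -
      have "d * norm q < d * (norm q + 1)" using d by simp
      also have "\<dots> = s - norm g" using norm_ge_zero[of q] by (simp add: d_def add_nonneg_eq_0_iff)
      finally show ?thesis by simp
    qed
    define v where "v n a = Q n g + a *\<^sub>R Q n q" for n and a :: real
    have vX: "v n a \<in> X n" if "n \<ge> 1" for n a
      unfolding v_def using that by (intro subspace_add subspace_scale subspaces Q_range)
    have v_lim: "(\<lambda>n. v n a) \<longlonglongrightarrow> g + a *\<^sub>R q" for a
      unfolding v_def by (intro tendsto_intros Q_lim)
    have "((\<lambda>a. g + a *\<^sub>R q) has_derivative (\<lambda>a. a *\<^sub>R q)) (at (0::real))"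
      by (auto intro!: derivative_eq_intros)
    from has_derivative_compose[OF this, of "\<lambda>g. \<Phi> (\<Upsilon> g)" "blinfun_apply D"] D
    have "((\<lambda>a. \<Phi> (\<Upsilon> (g + a *\<^sub>R q))) has_real_derivative blinfun_apply D q) (at 0)"
      by (simp add: has_field_derivative_def blinfun.scaleR_right mult_commute_abs)
    then have "\<forall>\<^sub>F n in sequentially. \<exists>a. \<bar>a\<bar> \<le> d \<and> \<Phi> (\<Upsilon>n n (v n a)) = \<Phi> (\<Upsilon> (g + 0 *\<^sub>R q))"
    proof (rule eventually_level_attained[OF _ Dq d])
      show "continuous_on {-d..d} (\<lambda>a. \<Phi> (\<Upsilon>n n (v n a)))" if "n \<ge> 1" for n
        using equicontinuous_family_imp_continuous_on
          [OF equicont[of "\<lambda>n. Q n g" g d q, OF Q_range Q_lim d]] that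
        by (simp add: v_def)
      show "(\<lambda>n. \<Phi> (\<Upsilon>n n (v n a))) \<longlonglongrightarrow> \<Phi> (\<Upsilon> (g + a *\<^sub>R q))" for a
        by (intro Phi_tendsto strong vX v_lim)
    qed
    moreover have "\<forall>\<^sub>F n in sequentially. norm (Q n g) + d * norm (Q n q) < s"
      by (rule order_tendstoD(2)[OF _ dq]) (intro tendsto_intros Q_lim)
    moreover have "\<forall>\<^sub>F n in sequentially. (1::nat) \<le> n" by (rule eventually_ge_at_top)
    ultimately show ?thesis
    proof eventually_elim
      case (elim n)
      then obtain a where a: "\<bar>a\<bar> \<le> d" "\<Phi> (\<Upsilon>n n (v n a)) = y" using g by auto
      have "norm (v n a) \<le> norm (Q n g) + \<bar>a\<bar> * norm (Q n q)"
        unfolding v_def by (metis norm_scaleR norm_triangle_ineq)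
      also have "\<dots> \<le> norm (Q n g) + d * norm (Q n q)"
        using a by (intro add_left_mono mult_right_mono) auto
      finally show ?case using elim a vX by (intro bexI[of _ "v n a"]) auto
    qed
  qed

  have limsup_norm: "\<forall>\<^sub>F n in sequentially. (norm (h n))\<^sup>2 < c"
    if g: "\<Phi> (\<Upsilon> g) = y" and c: "(norm g)\<^sup>2 < c" for g c
  proof -
    \<comment> \<open>\<open>s\<^sup>2\<close> is the midpoint of \<open>(norm g)\<^sup>2\<close>
      and \<open>c\<close>. Doubling the bound on \<open>\<epsilon> n\<close> below uses up the
      other half of the gap.\<close>
    define s where "s = sqrt (((norm g)\<^sup>2 + c) / 2)"
    have s2: "s\<^sup>2 = ((norm g)\<^sup>2 + c) / 2"
      unfolding s_def using c by (intro real_sqrt_pow2) (smt (verit) zero_le_power2 divide_nonneg_pos)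
    have "norm g < s" unfolding s_def using c by (intro real_less_rsqrt) simp
    with g have "\<forall>\<^sub>F n in sequentially. \<exists>v\<in>X n. \<Phi> (\<Upsilon>n n v) = y \<and> norm v < s"
      by (rule recovery)
    moreover have "\<forall>\<^sub>F n in sequentially. \<epsilon> n < (c - (norm g)\<^sup>2) / 4"
      using eps_lim c by (intro order_tendstoD(2)) auto
    moreover have "\<forall>\<^sub>F n in sequentially. (1::nat) \<le> n" by (rule eventually_ge_at_top)
    ultimately show ?thesis
    proof eventually_elim
      case (elim n)
      then obtain v where v: "v \<in> X n" "\<Phi> (\<Upsilon>n n v) = y" "norm v < s" by blast
      have "ereal (1/2 * (norm (h n))\<^sup>2) \<le> ereal (1/2 * (norm v)\<^sup>2) + ereal (\<epsilon> n)"
        using h_almost_min[OF elim(3)] discrete_rate_le[of v "X n" \<Phi> "\<Upsilon>n n" y, OF v(1,2)]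
        by (meson add_right_mono order_trans)
      then have "(norm (h n))\<^sup>2 \<le> (norm v)\<^sup>2 + 2 * \<epsilon> n" by simp
      moreover have "(norm v)\<^sup>2 < s\<^sup>2" using v(3) by (intro power_strict_mono) auto
      ultimately show ?case using elim(2) s2 by (simp add: field_simps)
    qed
  qed

  \<comment> \<open>A finite infimum means that the feasible set is nonempty.\<close>
  obtain g1 where g1: "\<Phi> (\<Upsilon> g1) = y"
    using finite_rate unfolding rate_def Inf_less_iff by blast
  have "\<forall>\<^sub>F n in sequentially. norm (h n) \<le> norm g1 + 1"
  proof -
    have "(norm g1)\<^sup>2 < (norm g1 + 1)\<^sup>2" by (intro power_strict_mono) auto
    from limsup_norm[OF g1 this] show ?thesis
      by eventually_elim (simp add: power2_less_imp_less less_imp_le)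
  qed
  then have "Bseq h" by (rule BfunI)
  then obtain B where B: "\<And>n. norm (h n) \<le> B" by (auto simp: Bseq_def)

  \<comment> \<open>Stated for every subsequence \<open>s\<close>, because convergence of the full
    sequences needs it for all of them.\<close>
  have minimizing_subseq: "\<exists>r x. strict_mono r \<and> (\<lambda>k. h (s (r k))) \<longlonglongrightarrow> x \<and>
      (\<lambda>k. u (s (r k))) \<longlonglongrightarrow> \<Upsilon> x \<and> minimizing_control \<Upsilon> \<Phi> y x"
    if s: "strict_mono s" "\<And>k. s k \<ge> 1" for s :: "nat \<Rightarrow> nat"
  proof -
    obtain r x where r: "strict_mono r" and weak: "weakly_converges ((\<lambda>k. h (s k)) \<circ> r) x"
      using bounded_seq_weakly_convergent_subseq[of "\<lambda>k. h (s k)" B] B by blast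
    have sr: "filterlim (\<lambda>k. s (r k)) at_top sequentially"
      using strict_mono_o[OF s(1) r] filterlim_subseq by (auto simp: o_def)
    have U: "(\<lambda>k. \<Upsilon>n (s (r k)) (h (s (r k)))) \<longlonglongrightarrow> \<Upsilon> x"
      using weak_consistency[OF sr, of "\<lambda>k. h (s (r k))" x] h_in s(2) weak by (simp add: o_def)
    have x: "\<Phi> (\<Upsilon> x) = y"
      using Phi_tendsto[OF U] h_feasible s(2) by (simp add: LIMSEQ_const_iff)
    have norms: "\<forall>\<^sub>F k in sequentially. (norm (h (s (r k))))\<^sup>2 < c"
      if "\<Phi> (\<Upsilon> g) = y" "(norm g)\<^sup>2 < c" for g c
      using eventually_compose_filterlim[OF limsup_norm[OF that] sr] .
    have hx: "(\<lambda>k. h (s (r k))) \<longlonglongrightarrow> x"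
      using weakly_converges_limsup_norm_imp_tendsto[OF weak] norms[OF x] by (simp add: o_def)
    \<comment> \<open>Norm convergence carries the asymptotic bound by any feasible \<open>g\<close>
      over to \<open>x\<close>; then \<open>c\<close> decreases to
      \<open>(norm g)\<^sup>2\<close>.\<close>
    have "norm x \<le> norm g" if g: "\<Phi> (\<Upsilon> g) = y" for g
    proof (rule power2_le_imp_le, rule dense_ge)
      fix c assume "(norm g)\<^sup>2 < c"
      from norms[OF g this] have "\<forall>\<^sub>F k in sequentially. (norm (h (s (r k))))\<^sup>2 \<le> c"
        by eventually_elim simp
      moreover have "(\<lambda>k. (norm (h (s (r k))))\<^sup>2) \<longlonglongrightarrow> (norm x)\<^sup>2"
        by (intro tendsto_intros hx)
      ultimately show "(norm x)\<^sup>2 \<le> c"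
        using tendsto_upperbound trivial_limit_sequentially by blast
    qed simp
    with x have "minimizing_control \<Upsilon> \<Phi> y x" by (rule minimizing_controlI)
    then show ?thesis using r hx U s(2) by (auto simp: u_eq)
  qed

  obtain r x where r: "strict_mono r" and hx: "(\<lambda>k. h (Suc (r k))) \<longlonglongrightarrow> x"
    and ux: "(\<lambda>k. u (Suc (r k))) \<longlonglongrightarrow> \<Upsilon> x" and min: "minimizing_control \<Upsilon> \<Phi> y x"
    using minimizing_subseq[of Suc] by (auto simp: strict_mono_Suc_iff)
  \<comment> \<open>Uniqueness forces the limit found along any subsequence to be
    \<open>x\<close>.\<close>
  have full: "h \<longlonglongrightarrow> x \<and> u \<longlonglongrightarrow> \<Upsilon> x" if uniq: "\<exists>!g. minimizing_control \<Upsilon> \<Phi> y g"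
  proof -
    have sub: "\<exists>r. (\<lambda>k. h (Suc (s (r k)))) \<longlonglongrightarrow> x \<and> (\<lambda>k. u (Suc (s (r k)))) \<longlonglongrightarrow> \<Upsilon> x"
      if "strict_mono s" for s :: "nat \<Rightarrow> nat"
      using minimizing_subseq[of "\<lambda>k. Suc (s k)"] that uniq min
      by (auto simp: strict_mono_Suc_iff)
    have "(\<lambda>n. h (Suc n)) \<longlonglongrightarrow> x" "(\<lambda>n. u (Suc n)) \<longlonglongrightarrow> \<Upsilon> x"
      by (rule tendsto_if_subsubseq_tendsto, use sub in blast)+
    then show ?thesis by (auto intro: LIMSEQ_imp_Suc)
  qed
  show ?thesis
    using r hx ux min full minimizing_control_state_cost[OF min]
    by (intro exI[of _ "\<lambda>k. Suc (r k)"] exI[of _ x] exI[of _ "\<Upsilon> x"])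
      (auto simp: strict_mono_Suc_iff minimizing_control_def)
qed

end
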